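(* Fix $B\ge0$ and a positive number $i_0$ with $\frac{B}{4i_0}<\frac12$. For integers $i\ge1$ let $$p_i=\begin{cases}\frac12-\frac{B}{4i}, & i>i_0,\\ \frac12, & i\le i_0,\end{cases}$$ and let $\{Z_n\}_{n\ge0}$ be the associated branching process with one immigrant per generation. If $B\ge1$, then almost surely $\{Z_n\}$ has at most finitely many regeneration times. If $B<1$, then almost surely $\{Z_n\}$ has infinitely many regeneration times.
   Context: Given numbers $0<p_k\le 1/2$, $k\ge1$, put $q_k=1-p_k$ and $f_k(s)=\frac{p_k}{1-q_ks}$ for $s\in[0,1]$ (a geometric probability generating function). Let $\{Z_n\}_{n\ge0}$ be a Markov chain with values in $\{0,1,2,\dots\}$ such that $Z_0=0$ and $$E\left(s^{Z_n}\mid Z_0,\dots,Z_{n-1}\right)=[f_n(s)]^{1+Z_{n-1}},\qquad n\ge1,\ s\in[0,1].$$ This is a branching process in varying environment with exactly one immigrant in each generation. An integer $n\ge0$ is called a regeneration time of $\{Z_n\}$ if $Z_n=0$. *)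

theory Defs
  imports "HOL-Probability.Probability"
begin

definition geom_pgf :: "real \<Rightarrow> real \<Rightarrow> real" where
  "geom_pgf p s = p / (1 - (1 - p) * s)"

text \<open>The sigma-algebra generated by \<open>Z 0, \<dots>, Z n\<close>; only its space and its measurable sets
  matter below, not its measure.\<close>

definition past :: "'a measure \<Rightarrow> (nat \<Rightarrow> 'a \<Rightarrow> nat) \<Rightarrow> nat \<Rightarrow> 'a measure" where
  "past M Z n =
     vimage_algebra (space M) (\<lambda>\<omega>. \<lambda>i\<in>{..n}. Z i \<omega>) (\<Pi>\<^sub>M i\<in>{..n}. count_space UNIV)"

text \<open>
  \<open>pgf_step\<close> conditions on the whole past, and its right-hand side depends on the past through
  \<open>Z n\<close> alone. Together with the fact that a law on the naturals is determined by its generating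
  function, it therefore contains the Markov property and the transition probabilities.
  The index is shifted by one: generation \<open>Suc n\<close> has offspring parameter \<open>p (Suc n)\<close>, and
  \<open>p 0\<close> plays no role. At \<open>s = 0\<close> the convention \<open>0 ^ 0 = 1\<close> is the one of generating functions.
\<close>

locale branching_with_immigration = prob_space M
  for M :: "'a measure" +
  fixes p :: "nat \<Rightarrow> real" and Z :: "nat \<Rightarrow> 'a \<Rightarrow> nat"
  assumes p_range: "\<And>k. 1 \<le> k \<Longrightarrow> 0 < p k \<and> p k \<le> 1 / 2"
    and Z_measurable [measurable]: "\<And>n. Z n \<in> measurable M (count_space UNIV)"
    and Z_init: "AE \<omega> in M. Z 0 \<omega> = 0"
    and pgf_step: "\<And>n s. 0 \<le> s \<Longrightarrow> s \<le> 1 \<Longrightarrow>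
      AE \<omega> in M. real_cond_exp M (past M Z n) (\<lambda>\<omega>'. s ^ Z (Suc n) \<omega>') \<omega>
                 = geom_pgf (p (Suc n)) s ^ (1 + Z n \<omega>)"

lemma (in branching_with_immigration) subalgebra_past: "subalgebra M (past M Z n)"
proof -
  have "(\<lambda>\<omega>. \<lambda>i\<in>{..n}. Z i \<omega>) \<in> measurable M (\<Pi>\<^sub>M i\<in>{..n}. count_space UNIV)"
    by measurable
  then have "sets (past M Z n) \<subseteq> sets M"
    unfolding past_def by (intro sets_image_in_sets) auto
  then show ?thesis
    by (simp add: subalgebra_def past_def)
qed

definition regeneration_times :: "(nat \<Rightarrow> 'a \<Rightarrow> nat) \<Rightarrow> 'a \<Rightarrow> nat set" where
  "regeneration_times Z \<omega> = {n. Z n \<omega> = 0}"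

definition perturbed_half :: "real \<Rightarrow> real \<Rightarrow> nat \<Rightarrow> real" where
  "perturbed_half B i0 i = (if real i > i0 then 1 / 2 - B / (4 * real i) else 1 / 2)"

lemma perturbed_half_range:
  assumes "0 \<le> B" "0 < i0" "B / (4 * i0) < 1 / 2"
  shows "0 < perturbed_half B i0 i \<and> perturbed_half B i0 i \<le> 1 / 2"
proof (cases "real i > i0")
  case True
  then have "B / (4 * real i) \<le> B / (4 * i0)"
    using assms by (intro divide_left_mono) auto
  then show ?thesis
    using True assms by (auto simp: perturbed_half_def)
qed (simp add: perturbed_half_def)

end

theory Submission
  imports Defs
begin

text \<open>
  Put \<open>R n = r 1 * \<dots> * r n\<close> with \<open>r i = p i / (1 - p i)\<close>. Linear fractional generating functions
  compose explicitly, and the product over the immigrants telescopes: given a zero at time \<open>k\<close>, the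
  probability of a zero at time \<open>n \<ge> k\<close> is \<open>R n / (R k + \<dots> + R n)\<close>.

  If \<open>B \<ge> 1\<close>, the unconditional probability of a zero at \<open>n\<close> is \<open>O(1 / (n ln n))\<close>, which is not
  summable when \<open>B = 1\<close>. But zeros cluster: after the first zero \<open>k\<close> of the dyadic block
  \<open>[2^m, 2^(m+1))\<close> the expected number of zeros in \<open>[k, 2 k]\<close> is at least of order \<open>m\<close>, whereas the
  expected number in \<open>[2^m, 2^(m+2))\<close> is \<open>O(1/m)\<close>. So the block is hit with probability
  \<open>O(1/m^2)\<close> and Borel--Cantelli applies.

  If \<open>B < 1\<close>, a zero at \<open>n\<close> has probability of order \<open>1/n\<close>, and conditioning on the past up to time
  \<open>k\<close> changes this only by a factor tending to 1. The number of zeros up to \<open>N\<close> has first moment of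
  order \<open>ln N\<close> and second moment \<open>O((ln N)^2)\<close>, so given any past a further zero occurs with
  probability at least a fixed \<open>\<delta> > 0\<close>. Applied to the event of no zero in \<open>(L, k]\<close>, with
  \<open>k\<close> tending to infinity, this makes the event of no zero after \<open>L\<close> null.
\<close>

section \<open>Elementary estimates for squares of sums and for harmonic sums\<close>

text \<open>By symmetry, doubling the sum over ordered pairs gives the full square plus the diagonal
  squares once more, and these are nonnegative. For indicators of zeros it reduces a second moment
  to pairs of times in increasing order.\<close>

lemma sum_square_le:
  fixes a :: "nat \<Rightarrow> real"
  assumes "m \<le> N"
  shows "(\<Sum>n=m..N. a n)\<^sup>2 \<le> 2 * (\<Sum>n=m..N. \<Sum>j=m..n. a j * a n)"
  using assms
proof (induction N rule: dec_induct)
  case base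
  show ?case by (simp add: power2_eq_square)
next
  case (step N)
  define S where "S = (\<Sum>n=m..N. a n)"
  have "(\<Sum>n=m..Suc N. a n)\<^sup>2 = S\<^sup>2 + 2 * (S * a (Suc N)) + (a (Suc N))\<^sup>2"
    using step.hyps by (simp add: S_def power2_eq_square algebra_simps)
  also have "\<dots> \<le> S\<^sup>2 + 2 * ((S + a (Suc N)) * a (Suc N))"
    by (simp add: power2_eq_square algebra_simps)
  also have "(S + a (Suc N)) * a (Suc N) = (\<Sum>j=m..Suc N. a j * a (Suc N))"
    using step.hyps unfolding sum_distrib_right[symmetric] by (simp add: S_def)
  finally show ?case
    using step unfolding S_def by simp
qed

lemma sum_inverse_eq_harm_diff:
  "k \<le> Suc n \<Longrightarrow> (\<Sum>i=k..n. 1 / real (Suc i)) = harm (Suc n) - harm k"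
proof (induction n)
  case 0
  then show ?case by (cases k) (auto simp: harm_expand)
next
  case (Suc n)
  then show ?case
    by (cases "k = Suc (Suc n)") (auto simp: harm_Suc inverse_eq_divide)
qed

lemma sum_inverse_shift_le_harm:
  assumes "m \<ge> k" "m \<le> N"
  shows "(\<Sum>j=m..N. 1 / real (j - k + 1)) \<le> harm (Suc N)"
proof -
  have "(\<Sum>j=m..N. 1 / real (j - k + 1)) \<le> (\<Sum>j=k..N. 1 / real (j - k + 1))"
    using assms by (intro sum_mono2) auto
  also have "\<dots> = (\<Sum>i=0..N-k. 1 / real (Suc i))"
    using assms by (intro sum.reindex_bij_witness[of _ "\<lambda>i. i + k" "\<lambda>i. i - k"]) auto
  also have "\<dots> = harm (Suc (N - k))"
    by (subst sum_inverse_eq_harm_diff) (auto simp: harm_expand)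
  also have "\<dots> \<le> harm (Suc N)"
    by (intro harm_mono) simp
  finally show ?thesis .
qed

text \<open>After exchanging the sums, the inner sum over \<open>n\<close> for fixed
  \<open>j\<close> is a harmonic sum, and so is the remaining sum over \<open>j\<close>. This bounds
  the second moment of a number of zeros by a squared logarithm.\<close>

lemma sum_sum_convolution_le_harm:
  assumes "m \<ge> k" "m \<le> N"
  shows "(\<Sum>n=m..N. \<Sum>j=m..n. 1 / real (j - k + 1) * (1 / real (n - j + 1))) \<le> (harm (Suc N))\<^sup>2"
proof -
  have "(\<Sum>n=m..N. \<Sum>j=m..n. 1 / real (j - k + 1) * (1 / real (n - j + 1)))
    = (\<Sum>n\<in>{m..N}. \<Sum>j\<in>{j\<in>{m..N}. j \<le> n}. 1 / real (j - k + 1) * (1 / real (n - j + 1)))"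
    by (intro sum.cong) auto
  also have "\<dots> = (\<Sum>j\<in>{m..N}. \<Sum>n\<in>{n\<in>{m..N}. j \<le> n}. 1 / real (j - k + 1) * (1 / real (n - j + 1)))"
    by (rule sum.swap_restrict) auto
  also have "\<dots> = (\<Sum>j=m..N. 1 / real (j - k + 1) * (\<Sum>n=j..N. 1 / real (n - j + 1)))"
    unfolding sum_distrib_left by (intro sum.cong) auto
  also have "\<dots> \<le> (\<Sum>j=m..N. 1 / real (j - k + 1) * harm (Suc N))"
    by (intro sum_mono mult_left_mono sum_inverse_shift_le_harm) auto
  also have "\<dots> = (\<Sum>j=m..N. 1 / real (j - k + 1)) * harm (Suc N)"
    by (simp add: sum_distrib_right)
  also have "\<dots> \<le> harm (Suc N) * harm (Suc N)"
    by (intro mult_right_mono sum_inverse_shift_le_harm assms harm_nonneg)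
  finally show ?thesis
    by (simp add: power2_eq_square)
qed

subsection \<open>Backward composition of the generating functions\<close>

context branching_with_immigration
begin

definition odds_prod :: "nat \<Rightarrow> real" where
  "odds_prod n = (\<Prod>i=1..n. p i / (1 - p i))"

definition odds_sum :: "nat \<Rightarrow> nat \<Rightarrow> real" where
  "odds_sum k n = (\<Sum>i=k..n. odds_prod i)"

definition zero_at :: "nat \<Rightarrow> 'a set" where
  "zero_at n = {\<omega> \<in> space M. Z n \<omega> = 0}"

lemma odds_prod_0 [simp]: "odds_prod 0 = 1"
  by (simp add: odds_prod_def)

lemma odds_prod_Suc: "odds_prod (Suc n) = odds_prod n * (p (Suc n) / (1 - p (Suc n)))"
  by (simp add: odds_prod_def)

lemma odds_pos: "0 < p (Suc n) / (1 - p (Suc n))"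
  using p_range[of "Suc n"] by auto

text \<open>The bound \<open>p \<le> 1 / 2\<close> makes \<open>odds_prod\<close> nonincreasing,
  which lets \<open>odds_sum\<close> be compared with its number of terms times its first or last
  term.\<close>

lemma odds_le_1: "p (Suc n) / (1 - p (Suc n)) \<le> 1"
  using p_range[of "Suc n"] by (simp add: divide_simps)

lemma odds_prod_pos: "0 < odds_prod n"
  by (induction n) (simp_all only: odds_prod_0 odds_prod_Suc mult_pos_pos[OF _ odds_pos] zero_less_one)

lemma decseq_odds_prod: "decseq odds_prod"
  unfolding odds_prod_Suc decseq_Suc_iff
  by (intro allI mult_right_le_one_le less_imp_le[OF odds_prod_pos] less_imp_le[OF odds_pos] odds_le_1)

lemma odds_prod_antimono: "m \<le> n \<Longrightarrow> odds_prod n \<le> odds_prod m"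
  using decseq_odds_prod by (rule decseqD)

lemma odds_sum_Suc: "k \<le> Suc n \<Longrightarrow> odds_sum k (Suc n) = odds_sum k n + odds_prod (Suc n)"
  by (simp add: odds_sum_def)

lemma odds_sum_head: "k \<le> n \<Longrightarrow> odds_sum k n = odds_prod k + odds_sum (Suc k) n"
  by (simp add: odds_sum_def sum.atLeast_Suc_atMost)

lemma odds_sum_nonneg: "0 \<le> odds_sum k n"
  unfolding odds_sum_def by (intro sum_nonneg less_imp_le odds_prod_pos)

lemma odds_sum_ge_first: "k \<le> n \<Longrightarrow> odds_prod k \<le> odds_sum k n"
  using odds_sum_nonneg[of "Suc k" n] by (simp add: odds_sum_head)

lemma odds_sum_pos: "k \<le> n \<Longrightarrow> 0 < odds_sum k n"
  using odds_sum_ge_first odds_prod_pos[of k] by (rule less_le_trans[rotated])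

lemma odds_sum_antimono: "j \<le> k \<Longrightarrow> odds_sum k n \<le> odds_sum j n"
  unfolding odds_sum_def by (intro sum_mono2) (auto intro: less_imp_le odds_prod_pos)

lemma odds_sum_ge: "k \<le> n \<Longrightarrow> real (n - k + 1) * odds_prod n \<le> odds_sum k n"
  unfolding odds_sum_def
  using sum_bounded_below[of "{k..n}" "odds_prod n" odds_prod] odds_prod_antimono
  by (simp add: Suc_diff_le)

lemma odds_sum_le: "k \<le> n \<Longrightarrow> odds_sum k n \<le> real (n - k + 1) * odds_prod k"
  unfolding odds_sum_def
  using sum_bounded_above[of "{k..n}" odds_prod "odds_prod k"] odds_prod_antimono
  by (simp add: Suc_diff_le)

lemma odds_ratio_le: "k \<le> n \<Longrightarrow> odds_prod n / odds_sum k n \<le> 1 / real (n - k + 1)"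
  using odds_sum_ge[of k n] odds_sum_pos[of k n] by (simp add: field_simps)

lemma odds_ratio_nonneg: "k \<le> n \<Longrightarrow> 0 \<le> odds_prod n / odds_sum k n"
  using odds_prod_pos[of n] odds_sum_pos[of k n] by simp

text \<open>The number \<open>1 - odds_prod k / odds_sum k n\<close> is the value at time
  \<open>k\<close> of the backward iteration that starts from 0 at time \<open>n\<close>. It has to
  stay in the unit interval for \<open>pgf_step\<close> to apply.\<close>

lemma base_nonneg: "k \<le> n \<Longrightarrow> 0 \<le> 1 - odds_prod k / odds_sum k n"
  using odds_sum_ge_first[of k n] odds_sum_pos[of k n] by (simp add: divide_simps)

lemma base_le_1: "k \<le> n \<Longrightarrow> 1 - odds_prod k / odds_sum k n \<le> 1"
  using odds_prod_pos[of k] odds_sum_pos[of k n] by simp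

text \<open>In the coordinate \<open>1 / (1 - s)\<close> each generating function acts affinely, which makes the
  backward iteration explicit.\<close>

lemma geom_pgf_base:
  assumes "k < n"
  shows "geom_pgf (p (Suc k)) (1 - odds_prod (Suc k) / odds_sum (Suc k) n)
    = odds_sum (Suc k) n / odds_sum k n"
    and "1 - odds_prod k / odds_sum k n = odds_sum (Suc k) n / odds_sum k n"
proof -
  define P V q where "P = odds_prod k" and "V = odds_sum (Suc k) n" and "q = p (Suc k)"
  have pos: "0 < P" "0 < V" "0 < q" "q \<le> 1/2"
    using odds_prod_pos odds_sum_pos[of "Suc k" n] assms p_range[of "Suc k"]
    by (auto simp: P_def V_def q_def)
  have V: "odds_sum k n = P + V" "odds_prod (Suc k) = P * (q / (1 - q))"
    using assms by (simp_all add: P_def V_def q_def odds_sum_head odds_prod_Suc)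
  have "1 - (1 - q) * (1 - P * (q / (1 - q)) / V) = q * (P + V) / V"
    using pos by (simp add: field_simps)
  then have "geom_pgf q (1 - P * (q / (1 - q)) / V) = V / (P + V)"
    using pos by (simp add: geom_pgf_def)
  then show "geom_pgf (p (Suc k)) (1 - odds_prod (Suc k) / odds_sum (Suc k) n)
    = odds_sum (Suc k) n / odds_sum k n"
    unfolding V P_def[symmetric] V_def[symmetric] q_def[symmetric] .
  show "1 - odds_prod k / odds_sum k n = odds_sum (Suc k) n / odds_sum k n"
    using pos V by (simp add: field_simps P_def V_def)
qed

subsection \<open>Conditional probabilities of zeros\<close>

lemma past_sets_M: "F \<in> sets (past M Z n) \<Longrightarrow> F \<in> sets M"
  using subalgebra_past[of n] by (auto simp: subalgebra_def)

lemma measurable_past: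
  assumes "j \<le> n"
  shows "Z j \<in> measurable (past M Z n) (count_space UNIV)"
proof -
  have "(\<lambda>\<omega>. (\<lambda>i\<in>{..n}. Z i \<omega>) j) \<in> measurable (past M Z n) (count_space UNIV)"
    unfolding past_def
    by (rule measurable_compose[OF measurable_vimage_algebra1 measurable_component_singleton])
      (use assms in \<open>auto simp: space_PiM PiE_def extensional_def\<close>)
  then show ?thesis
    using assms by simp
qed

lemma zero_at_past: "j \<le> n \<Longrightarrow> zero_at j \<in> sets (past M Z n)"
  using measurable_sets[OF measurable_past, of j n "{0}"]
  by (simp add: zero_at_def past_def vimage_def Int_def conj_commute)

lemma zero_at_M [measurable]: "zero_at n \<in> sets M"
  using zero_at_past[of n n] past_sets_M by auto

lemma past_mono: "F \<in> sets (past M Z k) \<Longrightarrow> k \<le> n \<Longrightarrow> F \<in> sets (past M Z n)"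
proof -
  assume k: "k \<le> n" and F: "F \<in> sets (past M Z k)"
  have "(\<lambda>\<omega>. \<lambda>i\<in>{..k}. Z i \<omega>) \<in> measurable (past M Z n) (\<Pi>\<^sub>M i\<in>{..k}. count_space UNIV)"
    using k by (intro measurable_restrict measurable_past) auto
  then have "sets (past M Z k) \<subseteq> sets (past M Z n)"
    by (subst past_def) (intro sets_image_in_sets, auto simp: past_def)
  with F show ?thesis by auto
qed

lemma integrable_power_Z [simp]:
  assumes "0 \<le> s" "s \<le> 1" "F \<in> sets M"
  shows "integrable M (\<lambda>\<omega>. indicat_real F \<omega> * s ^ Z n \<omega>)"
  using assms
  by (intro integrable_const_bound[where B=1]) (auto simp: indicator_def power_le_one)

lemma integrable_indicat_M: "F \<in> sets M \<Longrightarrow> integrable M (indicat_real F)"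
  by (intro integrable_real_indicator) (auto simp: less_top[symmetric])

text \<open>The defining property of conditional expectation, integrated over an event of the past.
  From here on only integrals over such events occur.\<close>

lemma pgf_step_integral:
  assumes F: "F \<in> sets (past M Z n)" and s: "0 \<le> s" "s \<le> 1"
  shows "(\<integral>\<omega>. indicat_real F \<omega> * s ^ Z (Suc n) \<omega> \<partial>M)
    = (\<integral>\<omega>. indicat_real F \<omega> * geom_pgf (p (Suc n)) s ^ (1 + Z n \<omega>) \<partial>M)"
proof -
  interpret S: finite_measure_subalgebra M "past M Z n"
    by unfold_locales (rule subalgebra_past)
  note FM [measurable] = past_sets_M[OF F]
  have "integrable M (\<lambda>\<omega>. s ^ Z (Suc n) \<omega>)"
    using s by (intro integrable_const_bound[where B=1]) (auto simp: power_le_one)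
  note S.real_cond_exp_intA[OF this F]
  also have "(\<integral>\<omega>\<in>F. real_cond_exp M (past M Z n) (\<lambda>\<omega>. s ^ Z (Suc n) \<omega>) \<omega> \<partial>M)
    = (\<integral>\<omega>\<in>F. geom_pgf (p (Suc n)) s ^ (1 + Z n \<omega>) \<partial>M)"
    unfolding set_lebesgue_integral_def
  proof (rule integral_cong_AE)
    show "AE \<omega> in M. indicat_real F \<omega> *\<^sub>R real_cond_exp M (past M Z n) (\<lambda>\<omega>. s ^ Z (Suc n) \<omega>) \<omega>
      = indicat_real F \<omega> *\<^sub>R geom_pgf (p (Suc n)) s ^ (1 + Z n \<omega>)"
      using pgf_step[OF s, of n] by eventually_elim simp
  qed auto
  finally show ?thesis
    unfolding set_lebesgue_integral_def real_scaleR_def .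
qed

text \<open>Downward induction on \<open>k\<close>. One step replaces the base \<open>s\<close> by
  its image under the generating function, raised to the power \<open>1 + Z k\<close>. The
  additional factor, due to the immigrant, equals \<open>odds_sum (Suc k) n / odds_sum k n\<close>,
  so the prefactors telescope.\<close>

lemma prob_zero_at:
  assumes "k \<le> n" "F \<in> sets (past M Z k)"
  shows "prob (F \<inter> zero_at n) = odds_prod n / odds_sum k n *
    (\<integral>\<omega>. indicat_real F \<omega> * (1 - odds_prod k / odds_sum k n) ^ Z k \<omega> \<partial>M)"
  using assms
proof (induction k rule: inc_induct)
  case base
  have "odds_prod n / odds_sum n n = 1"
    using odds_prod_pos[of n] by (simp add: odds_sum_def)
  \<comment> \<open>At \<open>k = n\<close> the base is 0, and since \<open>0 ^ 0 = 1\<close> the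
    power is the indicator of a zero at \<open>n\<close>.\<close>
  moreover have "(\<integral>\<omega>. indicat_real F \<omega> * 0 ^ Z n \<omega> \<partial>M) = (\<integral>\<omega>. indicat_real (F \<inter> zero_at n) \<omega> \<partial>M)"
    by (intro Bochner_Integration.integral_cong) (auto simp: zero_at_def indicator_def)
  moreover have "F \<inter> zero_at n \<in> sets M"
    using past_sets_M[OF base] by auto
  ultimately show ?case
    by simp
next
  case (step k)
  have F: "F \<in> sets (past M Z (Suc k))"
    using past_mono[OF step.prems] by simp
  have k: "k \<le> n" "Suc k \<le> n" "k < n"
    using step.hyps by auto
  note step.IH[OF F]
  also note pgf_step_integral[OF step.prems base_nonneg base_le_1, OF k(2) k(2)]
  also note geom_pgf_base(1)[OF k(3)]
  also note geom_pgf_base(2)[OF k(3), symmetric]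
  also have "(\<integral>\<omega>. indicat_real F \<omega> * (1 - odds_prod k / odds_sum k n) ^ (1 + Z k \<omega>) \<partial>M)
    = (1 - odds_prod k / odds_sum k n) *
      (\<integral>\<omega>. indicat_real F \<omega> * (1 - odds_prod k / odds_sum k n) ^ Z k \<omega> \<partial>M)"
    by (subst integral_mult_right_zero[symmetric]) (simp add: ac_simps)
  also have "odds_prod n / odds_sum (Suc k) n * \<dots> = odds_prod n / odds_sum k n *
    (\<integral>\<omega>. indicat_real F \<omega> * (1 - odds_prod k / odds_sum k n) ^ Z k \<omega> \<partial>M)"
    using odds_sum_pos[OF k(2)] unfolding geom_pgf_base(2)[OF k(3)] by simp
  finally show ?case .
qed

text \<open>On \<open>F\<close> the exponent \<open>Z k\<close> vanishes and the integrand is just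
  the indicator: the process starts afresh at a zero.\<close>

lemma prob_zero_at_zero:
  assumes "k \<le> n" "F \<in> sets (past M Z k)" "F \<subseteq> zero_at k"
  shows "prob (F \<inter> zero_at n) = odds_prod n / odds_sum k n * prob F"
proof -
  have "(\<integral>\<omega>. indicat_real F \<omega> * (1 - odds_prod k / odds_sum k n) ^ Z k \<omega> \<partial>M)
    = (\<integral>\<omega>. indicat_real F \<omega> \<partial>M)"
    using assms(3)
    by (intro Bochner_Integration.integral_cong) (auto simp: zero_at_def indicator_def)
  then show ?thesis
    using prob_zero_at[OF assms(1,2)] past_sets_M[OF assms(2)] by simp
qed

text \<open>Replacing the power by 1 compares with the case \<open>Z k = 0\<close>, in which a zero
  at \<open>n\<close> is most likely. The resulting bound is free of \<open>Z k\<close> and of the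
  parameters \<open>p\<close>.\<close>

lemma prob_zero_at_le:
  assumes "k \<le> n" "F \<in> sets (past M Z k)"
  shows "prob (F \<inter> zero_at n) \<le> prob F / real (n - k + 1)"
proof -
  have FM: "F \<in> sets M"
    using past_sets_M[OF assms(2)] .
  have "(\<integral>\<omega>. indicat_real F \<omega> * (1 - odds_prod k / odds_sum k n) ^ Z k \<omega> \<partial>M)
    \<le> (\<integral>\<omega>. indicat_real F \<omega> \<partial>M)"
    using base_nonneg[OF assms(1)] base_le_1[OF assms(1)] FM
    by (intro integral_mono integrable_power_Z integrable_indicat_M) (auto simp: mult_left_le power_le_one)
  then have "prob (F \<inter> zero_at n) \<le> odds_prod n / odds_sum k n * prob F"
    using FM odds_ratio_nonneg[OF assms(1)] unfolding prob_zero_at[OF assms]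
    by (intro mult_left_mono) simp_all
  also have "\<dots> \<le> 1 / real (n - k + 1) * prob F"
    by (intro mult_right_mono odds_ratio_le assms) simp
  finally show ?thesis by simp
qed

lemma prob_zero_at_unconditional: "prob (zero_at n) = odds_prod n / odds_sum 0 n"
proof -
  have "zero_at 0 \<in> sets (past M Z 0)" 
    using zero_at_past by simp
  moreover have "AE \<omega> in M. \<omega> \<in> zero_at 0"
    using Z_init by (auto simp: zero_at_def)
  ultimately have "prob (zero_at 0 \<inter> zero_at n) = odds_prod n / odds_sum 0 n" "AE \<omega> in M. \<omega> \<in> zero_at 0"
    using prob_zero_at_zero[of 0 n "zero_at 0"] prob_eq_1[of "zero_at 0"] by auto
  moreover from this(2) have "prob (zero_at 0 \<inter> zero_at n) = prob (zero_at n)"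
    by (intro finite_measure_eq_AE) auto
  ultimately show ?thesis by simp
qed

subsection \<open>Infinitely many zeros\<close>

text \<open>The claim amounts to \<open>odds_sum 0 n \<le> C * (real (Suc n) * odds_prod n)\<close>,
  shown by induction. The growth of \<open>n + 1\<close> outweighs the decay of
  \<open>odds_prod\<close> because \<open>\<beta> < 1\<close>.\<close>

lemma odds_ratio_ge_inverse:
  assumes \<beta>: "\<beta> < 1" and odds: "\<And>j. n0 < j \<Longrightarrow> (1 - p j) / p j \<le> 1 + \<beta> / real j"
  shows "\<exists>c>0. \<forall>n. c / real (Suc n) \<le> odds_prod n / odds_sum 0 n"
proof -
  \<comment> \<open>The first entry gives \<open>C * \<beta> + 1 \<le> C\<close>, which closes the
    induction step; the second settles all \<open>n \<le> n0\<close>.\<close>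
  define C where "C = max (1 / (1 - \<beta>)) (1 / odds_prod n0)"
  have C: "1 / odds_prod n0 \<le> C" "1 / (1 - \<beta>) \<le> C"
    by (simp_all add: C_def)
  have "C > 0"
    using C(1) odds_prod_pos[of n0] by (meson less_le_trans zero_less_divide_1_iff)
  have C\<beta>: "C * \<beta> + 1 \<le> C"
    using C(2) \<beta> by (simp add: field_simps)
  have small: "odds_sum 0 n \<le> C * (real (Suc n) * odds_prod n)" if "n \<le> n0" for n
  proof -
    have "1 \<le> C * odds_prod n0"
      using C(1) odds_prod_pos[of n0] by (simp add: field_simps)
    also have "\<dots> \<le> C * odds_prod n"
      using \<open>C > 0\<close> odds_prod_antimono[OF that] by simp
    finally have "real (Suc n) * 1 \<le> real (Suc n) * (C * odds_prod n)"
      by (intro mult_left_mono) auto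
    then show ?thesis
      using odds_sum_le[of 0 n] by (simp add: algebra_simps)
  qed
  have large: "odds_sum 0 n \<le> C * (real (Suc n) * odds_prod n)" if "n0 \<le> n" for n
    using that
  proof (induction n rule: dec_induct)
    case base
    show ?case by (rule small) simp
  next
    case (step n)
    define R where "R = odds_prod (Suc n)"
    have R: "R > 0" "odds_prod n = R * ((1 - p (Suc n)) / p (Suc n))"
      using p_range[of "Suc n"] odds_prod_pos[of "Suc n"] by (simp_all add: R_def odds_prod_Suc)
    have "odds_prod n \<le> R * (1 + \<beta> / real (Suc n))"
      unfolding R(2) using R(1) odds[of "Suc n"] step.hyps by (intro mult_left_mono) auto
    then have "real (Suc n) * odds_prod n \<le> real (Suc n) * (R * (1 + \<beta> / real (Suc n)))"
      by (intro mult_left_mono) auto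
    also have "\<dots> = R * (real (Suc n) + \<beta>)"
      by (simp add: field_simps)
    finally have "odds_sum 0 n \<le> C * (R * (real (Suc n) + \<beta>))"
      using step.IH \<open>C > 0\<close> by (meson le_less_trans mult_left_mono order_less_imp_le order_trans)
    then have "odds_sum 0 (Suc n) \<le> R * (C * real (Suc n) + (C * \<beta> + 1))"
      by (simp add: odds_sum_Suc R_def algebra_simps)
    also have "\<dots> \<le> R * (C * real (Suc n) + C)"
      using R(1) C\<beta> by (intro mult_left_mono add_left_mono) auto
    finally show ?case
      by (simp add: R_def algebra_simps)
  qed
  have "1 / C / real (Suc n) \<le> odds_prod n / odds_sum 0 n" for n
  proof -
    have "odds_sum 0 n \<le> C * (real (Suc n) * odds_prod n)"
      using large[of n] small[of n] by (cases "n0 \<le> n") simp_all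
    then have "1 / C / real (Suc n) * odds_sum 0 n
      \<le> 1 / C / real (Suc n) * (C * (real (Suc n) * odds_prod n))"
      using \<open>C > 0\<close> by (intro mult_left_mono) auto
    also have "\<dots> = odds_prod n"
      using \<open>C > 0\<close> by simp
    finally show ?thesis
      using odds_sum_pos[of 0 n] by (subst pos_le_divide_eq) auto
  qed
  then show ?thesis
    using \<open>C > 0\<close> by (intro exI[of _ "1 / C"]) auto
qed

text \<open>Since \<open>odds_sum 0 n\<close> is at least \<open>odds_prod 0 = 1\<close>, the
  hypothesis bounds \<open>odds_prod\<close> below by a harmonic term. Divergence drives the base of
  \<open>prob_zero_at\<close> to 1, so that the state at time \<open>k\<close> is forgotten.\<close>

lemma odds_sum_at_top:
  assumes "c > 0" "\<And>n. c / real (Suc n) \<le> odds_prod n / odds_sum 0 n"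
  shows "filterlim (odds_sum k) at_top sequentially"
proof -
  have prod: "c / real (Suc n) \<le> odds_prod n" for n
  proof -
    have "odds_prod n / odds_sum 0 n \<le> odds_prod n / 1"
      using odds_sum_ge_first[of 0 n] odds_prod_pos[of n] by (intro divide_left_mono) auto
    with assms(2)[of n] show ?thesis by simp
  qed
  have "filterlim (\<lambda>n. c * (- harm k + harm (Suc n))) at_top sequentially"
    using \<open>c > 0\<close>
    by (intro filterlim_tendsto_pos_mult_at_top[OF tendsto_const]
        filterlim_tendsto_add_at_top[OF tendsto_const] filterlim_compose[OF harm_at_top filterlim_Suc])
  then have "filterlim (\<lambda>n. c * (harm (Suc n) - harm k)) at_top sequentially"
    by simp
  then show ?thesis
  proof (rule filterlim_at_top_mono)
    show "\<forall>\<^sub>F n in sequentially. c * (harm (Suc n) - harm k) \<le> odds_sum k n"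
      using eventually_ge_at_top[of k]
    proof eventually_elim
      case (elim n)
      have "c * (harm (Suc n) - harm k) = (\<Sum>i=k..n. c / real (Suc i))"
        using elim by (subst sum_inverse_eq_harm_diff[symmetric]) (simp_all add: sum_distrib_left)
      also have "\<dots> \<le> odds_sum k n"
        unfolding odds_sum_def by (intro sum_mono prod)
      finally show ?case .
    qed
  qed
qed

text \<open>A second moment argument of Paley-Zygmund type for the number \<open>W\<close> of zeros
  in a window \<open>[m, N]\<close>, restricted to \<open>F\<close>. What matters later is that the
  constant depends on \<open>c\<close> alone, not on \<open>k\<close> or \<open>F\<close>.\<close>

lemma prob_hit_ge:
  assumes c: "c > 0" and ratio: "\<And>n. c / real (Suc n) \<le> odds_prod n / odds_sum 0 n"
    and F: "F \<in> sets (past M Z k)"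
  shows "\<exists>N. c\<^sup>2 / 32 * prob F \<le> prob (F \<inter> (\<Union>n\<in>{k<..N}. zero_at n))"
proof (cases "prob F = 0")
  case False
  then have F_pos: "prob F > 0"
    by (simp add: zero_less_measure_iff)
  note FM [measurable] = past_sets_M[OF F]
  have "(\<lambda>n. odds_prod k / odds_sum k n) \<longlonglongrightarrow> 0"
    by (intro tendsto_divide_0[OF tendsto_const] filterlim_at_top_imp_at_infinity odds_sum_at_top[OF c ratio])
  from tendsto_diff[OF tendsto_const[of 1] this]
  have base: "(\<lambda>n. 1 - odds_prod k / odds_sum k n) \<longlonglongrightarrow> 1" by simp
  \<comment> \<open>The shift by \<open>k\<close> keeps every base in the unit interval, so that the
    constant 1 dominates the whole sequence.\<close>
  have "(\<lambda>n. \<integral>\<omega>. indicat_real F \<omega> * (1 - odds_prod k / odds_sum k (n + k)) ^ Z k \<omega> \<partial>M)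
    \<longlonglongrightarrow> (\<integral>\<omega>. indicat_real F \<omega> \<partial>M)"
  proof (rule integral_dominated_convergence[where w = "\<lambda>_. 1"])
    show "AE \<omega> in M. (\<lambda>n. indicat_real F \<omega> * (1 - odds_prod k / odds_sum k (n + k)) ^ Z k \<omega>)
      \<longlonglongrightarrow> indicat_real F \<omega>"
    proof (rule AE_I2)
      fix \<omega>
      have "(\<lambda>n. indicat_real F \<omega> * (1 - odds_prod k / odds_sum k (n + k)) ^ Z k \<omega>)
        \<longlonglongrightarrow> indicat_real F \<omega> * 1 ^ Z k \<omega>"
        using LIMSEQ_ignore_initial_segment[OF base, of k]
        by (intro tendsto_mult tendsto_power tendsto_const)
      then show "(\<lambda>n. indicat_real F \<omega> * (1 - odds_prod k / odds_sum k (n + k)) ^ Z k \<omega>)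
        \<longlonglongrightarrow> indicat_real F \<omega>" by simp
    qed
    show "AE \<omega> in M. norm (indicat_real F \<omega> * (1 - odds_prod k / odds_sum k (n + k)) ^ Z k \<omega>) \<le> 1" for n
      using base_nonneg[of k "n + k"] base_le_1[of k "n + k"]
      by (intro AE_I2) (auto simp: indicator_def power_le_one power_abs)
  qed auto
  then have "(\<lambda>n. \<integral>\<omega>. indicat_real F \<omega> * (1 - odds_prod k / odds_sum k n) ^ Z k \<omega> \<partial>M) \<longlonglongrightarrow> prob F"
    using LIMSEQ_offset[of "\<lambda>n. \<integral>\<omega>. indicat_real F \<omega> * (1 - odds_prod k / odds_sum k n) ^ Z k \<omega> \<partial>M"]
    by simp
  then have "\<forall>\<^sub>F n in sequentially.
      prob F / 2 < (\<integral>\<omega>. indicat_real F \<omega> * (1 - odds_prod k / odds_sum k n) ^ Z k \<omega> \<partial>M)"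
    using F_pos by (intro order_tendstoD(1)) auto
  then have "\<forall>\<^sub>F m in sequentially. k < m \<and> (\<forall>n\<ge>m.
      prob F / 2 < (\<integral>\<omega>. indicat_real F \<omega> * (1 - odds_prod k / odds_sum k n) ^ Z k \<omega> \<partial>M))"
    by (intro eventually_conj eventually_gt_at_top eventually_all_ge_at_top)
  \<comment> \<open>From time \<open>m\<close> on, the effect of the past costs at most a factor
    2.\<close>
  then obtain m where "m > k" and m: "\<And>n. n \<ge> m \<Longrightarrow>
      prob F / 2 < (\<integral>\<omega>. indicat_real F \<omega> * (1 - odds_prod k / odds_sum k n) ^ Z k \<omega> \<partial>M)"
    by (auto dest: eventually_happens)
  have low: "prob (F \<inter> zero_at n) \<ge> c / 2 * prob F * (1 / real (Suc n))" if "n \<ge> m" for n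
  proof -
    have "c / real (Suc n) * (prob F / 2) \<le> odds_prod n / odds_sum k n *
      (\<integral>\<omega>. indicat_real F \<omega> * (1 - odds_prod k / odds_sum k n) ^ Z k \<omega> \<partial>M)"
    proof (intro mult_mono less_imp_le[OF m[OF that]])
      have "odds_prod n / odds_sum 0 n \<le> odds_prod n / odds_sum k n"
        using that \<open>m > k\<close> odds_sum_pos[of k n] odds_sum_pos[of 0 n] odds_prod_pos[of n]
        by (intro divide_left_mono odds_sum_antimono) auto
      then show "c / real (Suc n) \<le> odds_prod n / odds_sum k n"
        using ratio[of n] by linarith
      then show "0 \<le> odds_prod n / odds_sum k n"
        using that \<open>m > k\<close> by (intro odds_ratio_nonneg) auto
    qed auto
    also have "\<dots> = prob (F \<inter> zero_at n)"
      using prob_zero_at[OF _ F, of n] that \<open>m > k\<close> by simp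
    finally show ?thesis
      by (simp add: field_simps)
  qed
  have "\<forall>\<^sub>F n in sequentially. 2 * harm m \<le> (harm (Suc n) :: real)"
    using filterlim_compose[OF harm_at_top filterlim_Suc] unfolding filterlim_at_top by blast
  then have "\<forall>\<^sub>F n in sequentially. 2 * harm m \<le> (harm (Suc n) :: real) \<and> m \<le> n"
    by (intro eventually_conj eventually_ge_at_top)
  \<comment> \<open>With this \<open>N\<close> at least half of \<open>harm (Suc N)\<close> comes
    from times in \<open>[m, N]\<close>.\<close>
  then obtain N where N: "2 * harm m \<le> (harm (Suc N) :: real)" "N \<ge> m"
    by (auto dest: eventually_happens)
  define H :: real where "H = harm (Suc N)"
  have "H > 0" unfolding H_def by (intro harm_pos) simp
  define W where "W \<omega> = (\<Sum>n=m..N. indicat_real (zero_at n) \<omega>)" for \<omega>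
  define Q where "Q = F \<inter> (\<Union>n\<in>{k<..N}. zero_at n)"
  have [measurable]: "Q \<in> sets M" unfolding Q_def by auto
  have ind: "integrable M (indicat_real A)" if "A \<in> sets M" for A
    using that by (rule integrable_indicat_M)
  have FW: "indicat_real F \<omega> * W \<omega> = (\<Sum>n=m..N. indicat_real (F \<inter> zero_at n) \<omega>)" for \<omega>
    by (simp add: W_def sum_distrib_left indicator_inter_arith)
  have int1: "integrable M (\<lambda>\<omega>. indicat_real F \<omega> * W \<omega>)"
    unfolding FW by (intro Bochner_Integration.integrable_sum ind) auto
  have FW2: "indicat_real F \<omega> * (W \<omega>)\<^sup>2
    = (\<Sum>i=m..N. \<Sum>j=m..N. indicat_real (F \<inter> zero_at i \<inter> zero_at j) \<omega>)" for \<omega>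
  proof -
    have "(W \<omega>)\<^sup>2 = (\<Sum>i=m..N. \<Sum>j=m..N. indicat_real (zero_at i) \<omega> * indicat_real (zero_at j) \<omega>)"
      by (simp only: W_def power2_eq_square sum_product)
    then show ?thesis
      by (simp only: sum_distrib_left indicator_inter_arith mult.assoc)
  qed
  have int2: "integrable M (\<lambda>\<omega>. indicat_real F \<omega> * (W \<omega>)\<^sup>2)"
    unfolding FW2
    by (intro Bochner_Integration.integrable_sum ind) auto
  have "c / 4 * prob F * H \<le> c / 2 * prob F * (H - harm m)"
    using N c F_pos by (simp add: H_def field_simps)
  also have "\<dots> = (\<Sum>n=m..N. c / 2 * prob F * (1 / real (Suc n)))"
    using N unfolding H_def sum_distrib_left[symmetric]
    by (subst sum_inverse_eq_harm_diff) auto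
  also have "\<dots> \<le> (\<Sum>n=m..N. prob (F \<inter> zero_at n))"
    by (intro sum_mono low) simp
  also have "\<dots> = (\<integral>\<omega>. indicat_real F \<omega> * W \<omega> \<partial>M)"
    unfolding FW by (subst Bochner_Integration.integral_sum) (auto intro!: ind)
  finally have first: "c / 4 * prob F * H \<le> (\<integral>\<omega>. indicat_real F \<omega> * W \<omega> \<partial>M)" .
  \<comment> \<open>The bound \<open>prob_zero_at_le\<close> is used twice, first from time
    \<open>j\<close> with \<open>F \<inter> zero_at j\<close> as the past event, then from time
    \<open>k\<close> with \<open>F\<close>.\<close>
  have pair: "prob (F \<inter> zero_at j \<inter> zero_at n) \<le> prob F * (1 / real (j - k + 1) * (1 / real (n - j + 1)))"
    if "m \<le> j" "j \<le> n" for j n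
  proof -
    have "F \<inter> zero_at j \<in> sets (past M Z j)"
      using past_mono[OF F] zero_at_past[of j j] that \<open>m > k\<close> by auto
    from prob_zero_at_le[OF \<open>j \<le> n\<close> this]
    have "prob (F \<inter> zero_at j \<inter> zero_at n) \<le> prob (F \<inter> zero_at j) / real (n - j + 1)" .
    also have "\<dots> \<le> (prob F / real (j - k + 1)) / real (n - j + 1)"
      using that \<open>m > k\<close> by (intro divide_right_mono prob_zero_at_le F) auto
    finally show ?thesis by simp
  qed
  have "(\<integral>\<omega>. indicat_real F \<omega> * (W \<omega>)\<^sup>2 \<partial>M)
    \<le> (\<integral>\<omega>. 2 * (\<Sum>n=m..N. \<Sum>j=m..n. indicat_real (F \<inter> zero_at j \<inter> zero_at n) \<omega>) \<partial>M)"
  proof (intro integral_mono int2)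
    fix \<omega>
    have "indicat_real F \<omega> * (W \<omega>)\<^sup>2 \<le> indicat_real F \<omega> * (2 * (\<Sum>n=m..N. \<Sum>j=m..n.
        indicat_real (zero_at j) \<omega> * indicat_real (zero_at n) \<omega>))"
      unfolding W_def using N by (intro mult_left_mono sum_square_le) auto
    also have "\<dots> = 2 * (\<Sum>n=m..N. \<Sum>j=m..n. indicat_real (F \<inter> zero_at j \<inter> zero_at n) \<omega>)"
      by (simp only: sum_distrib_left indicator_inter_arith ac_simps)
    finally show "indicat_real F \<omega> * (W \<omega>)\<^sup>2
      \<le> 2 * (\<Sum>n=m..N. \<Sum>j=m..n. indicat_real (F \<inter> zero_at j \<inter> zero_at n) \<omega>)" .
  qed (auto intro!: integrable_mult_right Bochner_Integration.integrable_sum ind)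
  also have "\<dots> = 2 * (\<Sum>n=m..N. \<Sum>j=m..n. prob (F \<inter> zero_at j \<inter> zero_at n))"
    by (simp add: Bochner_Integration.integral_sum Bochner_Integration.integrable_sum ind)
  also have "\<dots> \<le> 2 * (\<Sum>n=m..N. \<Sum>j=m..n. prob F * (1 / real (j - k + 1) * (1 / real (n - j + 1))))"
    by (intro mult_left_mono sum_mono pair) auto
  also have "\<dots> = 2 * prob F * (\<Sum>n=m..N. \<Sum>j=m..n. 1 / real (j - k + 1) * (1 / real (n - j + 1)))"
    by (simp only: sum_distrib_left mult.assoc)
  also have "\<dots> \<le> 2 * prob F * H\<^sup>2"
    using N \<open>m > k\<close> unfolding H_def by (intro mult_left_mono sum_sum_convolution_le_harm) auto
  finally have second: "(\<integral>\<omega>. indicat_real F \<omega> * (W \<omega>)\<^sup>2 \<partial>M) \<le> 2 * prob F * H\<^sup>2" .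
  text \<open>On \<open>Q\<close> use \<open>2 * a * W - W\<^sup>2 \<le> a\<^sup>2\<close>; the constant \<open>8\<close> makes the first-moment term twice
    the second-moment one.\<close>
  define a where "a = 8 * H / c"
  have "2 * a * (c / 4 * prob F * H) - 2 * prob F * H\<^sup>2
    \<le> 2 * a * (\<integral>\<omega>. indicat_real F \<omega> * W \<omega> \<partial>M) - (\<integral>\<omega>. indicat_real F \<omega> * (W \<omega>)\<^sup>2 \<partial>M)"
    using c \<open>H > 0\<close> by (intro diff_mono mult_left_mono first second) (auto simp: a_def)
  also have "\<dots> = (\<integral>\<omega>. 2 * a * (indicat_real F \<omega> * W \<omega>) - indicat_real F \<omega> * (W \<omega>)\<^sup>2 \<partial>M)"
    using int1 int2 by simp
  also have "\<dots> \<le> (\<integral>\<omega>. a\<^sup>2 * indicat_real Q \<omega> \<partial>M)"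
  proof (intro integral_mono Bochner_Integration.integrable_diff integrable_mult_right int1 int2 ind)
    fix \<omega>
    show "2 * a * (indicat_real F \<omega> * W \<omega>) - indicat_real F \<omega> * (W \<omega>)\<^sup>2 \<le> a\<^sup>2 * indicat_real Q \<omega>"
    proof (cases "\<omega> \<in> Q")
      case True
      then show ?thesis
        using zero_le_power2[of "a - W \<omega>"] by (simp add: Q_def power2_eq_square algebra_simps)
    next
      case False
      then have "indicat_real F \<omega> = 0 \<or> W \<omega> = 0"
        using \<open>m > k\<close> by (auto simp: Q_def W_def indicator_def intro!: sum.neutral)
      then show ?thesis by auto
    qed
  qed auto
  also have "\<dots> = a\<^sup>2 * prob Q"
    by simp
  finally have "2 * H\<^sup>2 * prob F \<le> 64 * H\<^sup>2 / c\<^sup>2 * prob Q"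
    using c by (simp add: a_def power2_eq_square field_simps)
  then have "c\<^sup>2 / 32 * prob F \<le> prob Q"
    using c \<open>H > 0\<close> by (simp add: field_simps)
  then show ?thesis
    unfolding Q_def by blast
qed simp

lemma AE_infinite_regeneration_times:
  assumes c: "c > 0" and ratio: "\<And>n. c / real (Suc n) \<le> odds_prod n / odds_sum 0 n"
  shows "AE \<omega> in M. infinite (regeneration_times Z \<omega>)"
proof -
  have null: "prob (space M - (\<Union>n\<in>{L<..}. zero_at n)) = 0" for L
  proof -
    define G where "G k = space M - (\<Union>n\<in>{L<..k}. zero_at n)" for k
    define G' where "G' = space M - (\<Union>n\<in>{L<..}. zero_at n)"
    have G: "G k \<in> sets (past M Z k)" for k
    proof -
      have "space M = space (past M Z k)"
        by (simp add: past_def)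
      then show ?thesis
        unfolding G_def using zero_at_past by (auto intro!: sets.Diff sets.finite_UN)
    qed
    then have GM [measurable]: "G k \<in> sets M" for k
      using past_sets_M by blast
    have [measurable]: "G' \<in> sets M"
      unfolding G'_def by auto
    \<comment> \<open>The factor does not depend on \<open>k\<close>; letting \<open>G k\<close>
      decrease to \<open>G'\<close> therefore leaves probability 0 only.\<close>
    have "prob G' \<le> (1 - c\<^sup>2 / 32) * prob (G k)" if "L \<le> k" for k
    proof -
      obtain N where N: "c\<^sup>2 / 32 * prob (G k) \<le> prob (G k \<inter> (\<Union>n\<in>{k<..N}. zero_at n))"
        using prob_hit_ge[OF c ratio G] by blast
      have "prob G' \<le> prob (G k - (G k \<inter> (\<Union>n\<in>{k<..N}. zero_at n)))"
        using that by (intro finite_measure_mono) (auto simp: G_def G'_def)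
      also have "\<dots> = prob (G k) - prob (G k \<inter> (\<Union>n\<in>{k<..N}. zero_at n))"
        by (intro finite_measure_Diff) auto
      also have "\<dots> \<le> prob (G k) - c\<^sup>2 / 32 * prob (G k)"
        using N by simp
      finally show ?thesis by (simp add: algebra_simps)
    qed
    moreover have "(\<lambda>k. prob (G k)) \<longlonglongrightarrow> prob (\<Inter>k. G k)"
      by (intro finite_Lim_measure_decseq) (auto simp: decseq_def G_def)
    moreover have "(\<Inter>k. G k) = G'"
      unfolding G_def G'_def by auto (metis greaterThanAtMost_iff order_refl)
    ultimately have "prob G' \<le> (1 - c\<^sup>2 / 32) * prob G'"
      by (intro LIMSEQ_le_const[OF tendsto_mult[OF tendsto_const]]) auto
    then have "prob G' \<le> 0"
      using c by (simp add: algebra_simps mult_le_0_iff)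
    then show ?thesis
      by (simp add: G'_def measure_le_0_iff)
  qed
  have "AE \<omega> in M. \<omega> \<in> (\<Union>n\<in>{L<..}. zero_at n)" for L
    using null[of L] by (subst prob_eq_1[symmetric]) (auto simp: prob_compl)
  then have "AE \<omega> in M. \<forall>L. \<omega> \<in> (\<Union>n\<in>{L<..}. zero_at n)"
    by (simp only: AE_all_countable) blast
  then show ?thesis
  proof eventually_elim
    case (elim \<omega>)
    then show ?case
      unfolding infinite_nat_iff_unbounded by (fastforce simp: regeneration_times_def zero_at_def)
  qed
qed

subsection \<open>Finitely many zeros\<close>

text \<open>The hypothesis makes \<open>(n + 1) * odds_prod n\<close> nonincreasing beyond
  \<open>n0\<close>. In the induction for \<open>odds_sum 0 n\<close>, the new summand pays for the
  growth of the logarithm. At \<open>n = 0\<close> the logarithm vanishes, hence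
  \<open>n \<ge> 1\<close>.\<close>

lemma odds_ratio_le_log:
  assumes odds: "\<And>j. n0 < j \<Longrightarrow> p j / (1 - p j) \<le> real j / (real j + 1)"
  shows "\<exists>C>0. \<forall>n\<ge>1. odds_prod n / odds_sum 0 n \<le> C / (real (Suc n) * ln (real (Suc n)))"
proof -
  \<comment> \<open>The logarithm in the denominator settles \<open>n \<le> n0\<close>; the 2 gives
    \<open>c \<le> 1 / 2\<close>, which absorbs \<open>(x + 1) / x \<le> 2\<close> in the induction
    step.\<close>
  define c where "c = 1 / (2 + ln (real (Suc n0)))"
  have c: "c > 0" "c \<le> 1 / 2"
    by (simp_all add: c_def field_simps add_pos_nonneg)
  have small: "c * (real (Suc n) * ln (real (Suc n)) * odds_prod n) \<le> odds_sum 0 n" if "n \<le> n0" for n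
  proof -
    have "ln (real (Suc n)) \<le> 2 + ln (real (Suc n0))"
      using that by (simp add: add_increasing)
    then have "c * ln (real (Suc n)) \<le> 1"
      by (simp add: c_def divide_simps add_pos_nonneg)
    then have "c * ln (real (Suc n)) * (real (Suc n) * odds_prod n) \<le> 1 * (real (Suc n) * odds_prod n)"
      using odds_prod_pos[of n] by (intro mult_right_mono) auto
    then show ?thesis
      using odds_sum_ge[of 0 n] by (simp add: algebra_simps)
  qed
  have large: "c * (real (Suc n) * ln (real (Suc n)) * odds_prod n) \<le> odds_sum 0 n" if "n0 \<le> n" for n
    using that
  proof (induction n rule: dec_induct)
    case base
    show ?case by (rule small) simp
  next
    case (step n)
    define R x where "R = odds_prod (Suc n)" and "x = real (Suc n)"
    have R: "R > 0" and x: "x \<ge> 1"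
      using odds_prod_pos[of "Suc n"] by (simp_all add: R_def x_def)
    have "R \<le> odds_prod n * (x / (x + 1))"
      unfolding R_def odds_prod_Suc x_def using odds[of "Suc n"] odds_prod_pos[of n] step.hyps
      by (intro mult_left_mono) auto
    then have "R * (x + 1) \<le> x * odds_prod n"
      using x by (simp add: field_simps)
    then have "c * ln x * (R * (x + 1)) \<le> c * ln x * (x * odds_prod n)"
      using c x by (intro mult_left_mono) auto
    also have "\<dots> \<le> odds_sum 0 n"
      using step.IH by (simp add: x_def algebra_simps)
    finally have IH: "c * ln x * (R * (x + 1)) \<le> odds_sum 0 n" .
    have "ln (x + 1) - ln x = ln (1 + 1 / x)"
      using x ln_div[of "x + 1" x] by (simp add: add_divide_distrib)
    also have "\<dots> \<le> 1 / x"
      using x by (intro ln_add_one_self_le_self) auto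
    finally have "c * (x + 1) * (ln (x + 1) - ln x) \<le> c * (x + 1) * (1 / x)"
      using c x by (intro mult_left_mono) auto
    also have "\<dots> \<le> (1 / 2) * (x + 1) * (1 / x)"
      using c x by (intro mult_right_mono) auto
    also have "\<dots> \<le> 1"
      using x by (simp add: field_simps)
    finally have "R * (c * (x + 1) * (ln (x + 1) - ln x)) \<le> R * 1"
      using R by (intro mult_left_mono) auto
    with IH have "c * ((x + 1) * ln (x + 1) * R) \<le> odds_sum 0 n + R"
      by (simp add: algebra_simps)
    then show ?case
      by (simp add: odds_sum_Suc R_def x_def algebra_simps)
  qed
  have "odds_prod n / odds_sum 0 n \<le> 1 / c / (real (Suc n) * ln (real (Suc n)))" if "n \<ge> 1" for n
  proof -
    define y where "y = real (Suc n) * ln (real (Suc n))"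
    have y: "y > 0"
      using that by (simp add: y_def)
    have "c * (y * odds_prod n) \<le> odds_sum 0 n"
      unfolding y_def using large[of n] small[of n] by (cases "n0 \<le> n") simp_all
    then have "odds_prod n \<le> 1 / c / y * odds_sum 0 n"
      using c(1) y by (simp add: field_simps)
    then show ?thesis
      unfolding y_def[symmetric] using odds_sum_pos[of 0 n] by (subst pos_divide_le_eq) auto
  qed
  then show ?thesis
    using c by (intro exI[of _ "1 / c"]) auto
qed

text \<open>Between \<open>k\<close> and \<open>n\<close> there are at most \<open>k\<close>
  factors, each at least \<open>1 - b / k\<close>, hence at least \<open>exp (- 2 * b / k)\<close>.
  The condition \<open>2 * b \<le> k\<close> is what the lower bound for the logarithm
  needs.\<close>

lemma odds_prod_doubling:
  assumes b: "0 \<le> b" "2 * b \<le> real k" and odds: "\<And>j. 0 < j \<Longrightarrow> 1 - b / real j \<le> p j / (1 - p j)"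
    and n: "0 < k" "k \<le> n" "n \<le> 2 * k"
  shows "exp (- 2 * b) * odds_prod k \<le> odds_prod n"
proof -
  define e where "e = exp (- 2 * b / real k)"
  have e_le: "e \<le> 1 - b / real k"
  proof -
    define x where "x = b / real k"
    have x: "0 \<le> x" "x \<le> 1 / 2"
      using b n by (auto simp: x_def field_simps)
    have "- (2 * x) \<le> - x - 2 * x\<^sup>2"
      using mult_left_mono[OF x(2), of x] x by (simp add: power2_eq_square)
    also have "\<dots> \<le> ln (1 - x)"
      by (rule ln_one_minus_pos_lower_bound[OF x])
    finally have "exp (- (2 * x)) \<le> exp (ln (1 - x))" by simp
    also have "\<dots> = 1 - x"
      using x by (intro exp_ln) linarith
    finally show ?thesis
      by (simp add: e_def x_def)
  qed
  have "e ^ d * odds_prod k \<le> odds_prod (k + d)" for d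
  proof (induction d)
    case (Suc d)
    have "e \<le> 1 - b / real (Suc (k + d))"
      using e_le b n by (elim order_trans) (simp add: frac_le)
    also have "\<dots> \<le> p (Suc (k + d)) / (1 - p (Suc (k + d)))"
      by (rule odds) simp
    finally have "odds_prod (k + d) * e \<le> odds_prod (Suc (k + d))"
      using odds_prod_pos[of "k + d"] unfolding odds_prod_Suc by (intro mult_left_mono) auto
    moreover have "e * (e ^ d * odds_prod k) \<le> e * odds_prod (k + d)"
      using Suc by (intro mult_left_mono) (auto simp: e_def)
    ultimately show ?case by (simp add: ac_simps)
  qed simp
  from this[of "n - k"] have "e ^ (n - k) * odds_prod k \<le> odds_prod n"
    using n by simp
  moreover have "exp (- 2 * b) \<le> e ^ (n - k)"
  proof -
    have "exp (- 2 * b) = e ^ k"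
      using n by (simp add: e_def exp_of_nat_mult[symmetric])
    also have "\<dots> \<le> e ^ (n - k)"
      using n b by (intro power_decreasing) (auto simp: e_def)
    finally show ?thesis .
  qed
  ultimately show ?thesis
    using odds_prod_pos[of k] by (meson less_imp_le mult_right_mono order_trans)
qed

text \<open>Double counting of pairs of a first zero \<open>k\<close> in the block and a zero
  \<open>n\<close> in \<open>J\<close>. Each first zero brings about \<open>m\<close> further zeros
  on average, while all zeros in \<open>J\<close> together have expected number of order
  \<open>1 / m\<close>.\<close>

lemma prob_dyadic_block_le:
  assumes C: "C > 0" "\<And>n. 1 \<le> n \<Longrightarrow> odds_prod n / odds_sum 0 n \<le> C / (real (Suc n) * ln (real (Suc n)))"
    and c: "c > 0" "\<And>k n. 2 ^ m \<le> k \<Longrightarrow> k \<le> n \<Longrightarrow> n \<le> 2 * k \<Longrightarrow> c * odds_prod k \<le> odds_prod n"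
    and m: "m \<ge> 1"
  shows "prob (\<Union>n\<in>{2^m..<2^Suc m}. zero_at n) \<le> 4 * C / (c * (ln 2)\<^sup>2) * (1 / real m ^ 2)"
proof -
  \<comment> \<open>\<open>J\<close> reaches up to \<open>4 * 2 ^ m\<close> so that it contains
    \<open>{k..2*k}\<close> for every \<open>k\<close> in the block \<open>I\<close>.\<close>
  define I J :: "nat set" where "I = {2^m..<2^Suc m}" and "J = {2^m..<4*2^m}"
  define first where "first k = zero_at k - (\<Union>j\<in>{2^m..<k}. zero_at j)" for k
  have past: "first k \<in> sets (past M Z k)" for k
    unfolding first_def using zero_at_past by (intro sets.Diff sets.finite_UN) auto
  then have [measurable]: "first k \<in> sets M" for k
    using past_sets_M by blast
  have sub: "first k \<subseteq> zero_at k" for k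
    by (auto simp: first_def)
  have disj: "disjoint_family_on first I"
    unfolding disjoint_family_on_def
  proof (intro ballI impI)
    fix i j assume "i \<in> I" "j \<in> I" "i \<noteq> j"
    then show "first i \<inter> first j = {}"
      by (cases "i < j") (auto simp: first_def I_def)
  qed
  have union: "(\<Union>n\<in>I. zero_at n) = (\<Union>k\<in>I. first k)"
  proof (intro equalityI subsetI)
    fix \<omega> assume "\<omega> \<in> (\<Union>n\<in>I. zero_at n)"
    then obtain n where n: "n \<in> I" "\<omega> \<in> zero_at n" by blast
    define k where "k = (LEAST k. k \<in> I \<and> \<omega> \<in> zero_at k)"
    have k: "k \<in> I" "\<omega> \<in> zero_at k"
      unfolding k_def by (rule LeastI2[of _ n], use n in auto)+
    have "\<omega> \<notin> zero_at j" if "j \<in> {2^m..<k}" for j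
      using not_less_Least[of j "\<lambda>k. k \<in> I \<and> \<omega> \<in> zero_at k", folded k_def] that k(1)
      by (auto simp: I_def)
    with k show "\<omega> \<in> (\<Union>k\<in>I. first k)"
      by (auto simp: first_def)
  qed (use sub in auto)
  have weight: "c * (real m * ln 2) * prob (first k) \<le> (\<Sum>n\<in>J. prob (first k \<inter> zero_at n))" if "k \<in> I" for k
  proof -
    have k: "2 ^ m \<le> k" "2 * k < 4 * 2 ^ m" "0 < k"
      using that by (auto simp: I_def intro: less_le_trans[of 0 "2 ^ m"])
    have "(2::real) ^ m \<le> real k"
      using k(1) by simp
    then have r: "(2::real) ^ m \<le> real (Suc k) + 1"
      by linarith
    have "real m * ln 2 = ln (2 ^ m)"
      by (simp add: ln_realpow)
    also have "\<dots> \<le> ln (real (Suc k) + 1)"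
      using r by (subst ln_le_cancel_iff) auto
    also have "\<dots> \<le> harm (Suc k)"
      by (rule ln_le_harm)
    also have "\<dots> = (\<Sum>i=0..k. 1 / real (Suc i))"
      by (subst sum_inverse_eq_harm_diff) (auto simp: harm_expand)
    also have "\<dots> = (\<Sum>n=k..2*k. 1 / real (n - k + 1))"
      by (intro sum.reindex_bij_witness[of _ "\<lambda>i. i - k" "\<lambda>i. i + k"]) auto
    finally have "c * (real m * ln 2) * prob (first k) \<le> c * (\<Sum>n=k..2*k. 1 / real (n - k + 1)) * prob (first k)"
      using c(1) by (intro mult_right_mono mult_left_mono) auto
    also have "\<dots> = (\<Sum>n=k..2*k. c * (1 / real (n - k + 1)) * prob (first k))"
      by (simp add: sum_distrib_left sum_distrib_right)
    also have "\<dots> \<le> (\<Sum>n=k..2*k. prob (first k \<inter> zero_at n))"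
    proof (intro sum_mono)
      fix n assume n: "n \<in> {k..2*k}"
      then have kn: "k \<le> n" by simp
      \<comment> \<open>\<open>odds_sum k n\<close> is at most its number of terms times
        \<open>odds_prod k\<close>, and up to time \<open>2 * k\<close> the product
        \<open>odds_prod n\<close> has lost at most the factor \<open>c\<close>.\<close>
      have "c * odds_prod k * odds_sum k n \<le> odds_prod n * (real (n - k + 1) * odds_prod k)"
        using n odds_sum_nonneg[of k n] odds_sum_le[OF kn] odds_prod_pos[of n]
        by (intro mult_mono c(2)[OF k(1)]) auto
      then have "odds_prod k * (c * odds_sum k n) \<le> odds_prod k * (odds_prod n * real (n - k + 1))"
        by (simp only: ac_simps)
      then have "c * odds_sum k n \<le> odds_prod n * real (n - k + 1)"
        using odds_prod_pos[of k] by (simp only: mult_le_cancel_left_pos)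
      then have "c * (1 / real (n - k + 1)) \<le> odds_prod n / odds_sum k n"
        using odds_sum_pos[OF kn] by (simp add: field_simps)
      then have "c * (1 / real (n - k + 1)) * prob (first k) \<le> odds_prod n / odds_sum k n * prob (first k)"
        by (intro mult_right_mono) auto
      then show "c * (1 / real (n - k + 1)) * prob (first k) \<le> prob (first k \<inter> zero_at n)"
        unfolding prob_zero_at_zero[OF kn past sub] .
    qed
    also have "\<dots> \<le> (\<Sum>n\<in>J. prob (first k \<inter> zero_at n))"
      using k by (intro sum_mono2) (auto simp: J_def)
    finally show ?thesis .
  qed
  have ln_m: "c * (real m * ln 2) > 0" "real m * ln 2 > 0"
    using c m by auto
  have "c * (real m * ln 2) * prob (\<Union>n\<in>I. zero_at n) = (\<Sum>k\<in>I. c * (real m * ln 2) * prob (first k))"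
    unfolding union sum_distrib_left[symmetric]
    by (subst finite_measure_finite_Union[OF _ _ disj]) (auto simp: I_def)
  also have "\<dots> \<le> (\<Sum>k\<in>I. \<Sum>n\<in>J. prob (first k \<inter> zero_at n))"
    by (intro sum_mono weight)
  also have "\<dots> = (\<Sum>n\<in>J. \<Sum>k\<in>I. prob (first k \<inter> zero_at n))"
    by (rule sum.swap)
  \<comment> \<open>By disjointness of the events \<open>first k\<close>, the inner sum is the
    probability of one event contained in \<open>zero_at n\<close>.\<close>
  also have "\<dots> = (\<Sum>n\<in>J. prob (\<Union>k\<in>I. first k \<inter> zero_at n))"
  proof (intro sum.cong refl)
    fix n
    have "disjoint_family_on (\<lambda>k. first k \<inter> zero_at n) I"
      using disj unfolding disjoint_family_on_def by blast
    then show "(\<Sum>k\<in>I. prob (first k \<inter> zero_at n)) = prob (\<Union>k\<in>I. first k \<inter> zero_at n)"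
      by (subst finite_measure_finite_Union) (auto simp: I_def)
  qed
  also have "\<dots> \<le> (\<Sum>n\<in>J. C / (2 ^ m * (real m * ln 2)))"
  proof (intro sum_mono)
    fix n assume n: "n \<in> J"
    then have nm: "2 ^ m \<le> n" "1 \<le> n"
      using one_le_power[of "2::nat" m] unfolding J_def atLeastLessThan_iff by linarith+
    have "(2::real) ^ m \<le> real n"
      using nm(1) by simp
    then have r: "2 ^ m \<le> real (Suc n)"
      by linarith
    have "prob (\<Union>k\<in>I. first k \<inter> zero_at n) \<le> prob (zero_at n)"
      by (intro finite_measure_mono) auto
    also have "\<dots> \<le> C / (real (Suc n) * ln (real (Suc n)))"
      unfolding prob_zero_at_unconditional by (rule C(2)[OF nm(2)])
    also have "\<dots> \<le> C / (2 ^ m * (real m * ln 2))"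
    proof (rule divide_left_mono)
      have "real m * ln 2 = ln (2 ^ m)"
        by (simp add: ln_realpow)
      also have "\<dots> \<le> ln (real (Suc n))"
        using r by (subst ln_le_cancel_iff) auto
      finally show "2 ^ m * (real m * ln 2) \<le> real (Suc n) * ln (real (Suc n))"
        using r ln_m by (intro mult_mono) auto
      then show "0 < real (Suc n) * ln (real (Suc n)) * (2 ^ m * (real m * ln 2))"
        using ln_m by (meson less_le_trans mult_pos_pos zero_less_numeral zero_less_power)
    qed (use C in auto)
    finally show "prob (\<Union>k\<in>I. first k \<inter> zero_at n) \<le> C / (2 ^ m * (real m * ln 2))" .
  qed
  \<comment> \<open>\<open>J\<close> has \<open>3 * 2 ^ m\<close> elements; 4 is a rounder
    bound.\<close>
  also have "\<dots> \<le> 4 * C / (real m * ln 2)"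
    using C(1) ln_m(2) by (simp add: J_def divide_simps)
  finally have "prob (\<Union>n\<in>I. zero_at n) \<le> 4 * C / (real m * ln 2) / (c * (real m * ln 2))"
    using ln_m(1) by (subst pos_le_divide_eq) (simp_all add: mult.commute)
  then show ?thesis
    unfolding I_def by (simp add: power2_eq_square field_simps)
qed

lemma AE_finite_regeneration_times:
  assumes upper: "\<And>j. n0 < j \<Longrightarrow> p j / (1 - p j) \<le> real j / (real j + 1)"
    and lower: "\<And>j. 0 < j \<Longrightarrow> 1 - b / real j \<le> p j / (1 - p j)" and b: "0 \<le> b"
  shows "AE \<omega> in M. finite (regeneration_times Z \<omega>)"
proof -
  obtain C where C: "C > 0"
    "\<And>n. 1 \<le> n \<Longrightarrow> odds_prod n / odds_sum 0 n \<le> C / (real (Suc n) * ln (real (Suc n)))"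
    using odds_ratio_le_log[OF upper] by blast
  define H where "H m = (\<Union>n\<in>{2^m..<2^Suc m}. zero_at n)" for m :: nat
  have [measurable]: "H m \<in> sets M" for m
    unfolding H_def by auto
  \<comment> \<open>For \<open>m > m0\<close> every \<open>k\<close> in the block satisfies
    \<open>2 * b \<le> m0 < m < 2 ^ m \<le> k\<close>, as the doubling estimate requires.\<close>
  obtain m0 :: nat where m0: "2 * b \<le> real m0"
    using real_arch_simple by blast
  have block: "norm (prob (H m)) \<le> 4 * C / (exp (- 2 * b) * (ln 2)\<^sup>2) * (1 / real m ^ 2)" if "m \<ge> Suc m0" for m
  proof -
    have "exp (- 2 * b) * odds_prod k \<le> odds_prod n" if "2 ^ m \<le> k" "k \<le> n" "n \<le> 2 * k" for k n
    proof (rule odds_prod_doubling[OF b _ lower])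
      have "m0 \<le> m" "m < 2 ^ m"
        using \<open>m \<ge> Suc m0\<close> by auto
      with that(1) have "m0 \<le> k" "0 < k"
        by linarith+
      then show "2 * b \<le> real k" "0 < k"
        using m0 by auto
    qed (use that in auto)
    from prob_dyadic_block_le[OF C _ this, of m] that show ?thesis
      by (simp add: H_def)
  qed
  have "summable (\<lambda>m. 4 * C / (exp (- 2 * b) * (ln 2)\<^sup>2) * (1 / real m ^ 2))"
    using inverse_power_summable[of 2, where 'a = real]
    by (intro summable_mult) (simp add: inverse_eq_divide)
  then have "summable (\<lambda>m. prob (H m))"
    by (rule summable_comparison_test') (rule block)
  then have "AE \<omega> in M. eventually (\<lambda>m. \<omega> \<in> space M - H m) sequentially"
    by (intro borel_cantelli_AE1) (auto simp: less_top[symmetric])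
  then show ?thesis
  proof eventually_elim
    case (elim \<omega>)
    then obtain K where K: "\<And>m. m \<ge> K \<Longrightarrow> \<omega> \<in> space M - H m"
      by (auto simp: eventually_sequentially)
    have "regeneration_times Z \<omega> \<subseteq> {..<2 ^ K}"
    proof (intro subsetI, rule ccontr)
      fix n assume n: "n \<in> regeneration_times Z \<omega>" "n \<notin> {..<2 ^ K}"
      then have "n \<ge> 2 ^ K" "n > 0"
        by (auto intro: less_le_trans[of 0 "2 ^ K"])
      then obtain m where m: "2 ^ m \<le> n" "n < 2 ^ Suc m"
        using ex_power_ivl1[of 2 n] by auto
      then have "(2::nat) ^ K < 2 ^ Suc m"
        using \<open>n \<ge> 2 ^ K\<close> by linarith
      then have "K \<le> m"
        by (simp add: power_strict_increasing_iff less_Suc_eq_le del: power_Suc)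
      moreover have "\<omega> \<in> H m"
        using n m K[of K] by (auto simp: H_def zero_at_def regeneration_times_def)
      ultimately show False
        using K by blast
    qed
    then show ?case
      by (rule finite_subset) simp
  qed
qed

end

section \<open>Odds of the perturbed parameters and the threshold at 1\<close>

theorem theorem2:
  fixes M :: "'a measure" and Z :: "nat \<Rightarrow> 'a \<Rightarrow> nat" and B i0 :: real
  assumes "0 \<le> B" and "0 < i0" and "B / (4 * i0) < 1 / 2"
    and "branching_with_immigration M (perturbed_half B i0) Z"
  shows "(1 \<le> B \<longrightarrow> (AE \<omega> in M. finite (regeneration_times Z \<omega>))) \<and>
         (B < 1 \<longrightarrow> (AE \<omega> in M. infinite (regeneration_times Z \<omega>)))"
proof -
  let ?p = "perturbed_half B i0"
  interpret branching_with_immigration M ?p Z by fact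
  \<comment> \<open>The odds are \<open>1 - B / j\<close> up to second order, so \<open>B\<close> is
    to be compared with the exponent 1 of the harmonic series.\<close>
  have p_eq: "?p j / (1 - ?p j) = (2 * real j - B) / (2 * real j + B)"
      "(1 - ?p j) / ?p j = (2 * real j + B) / (2 * real j - B)" "B < 2 * real j"
    if "real j > i0" for j
  proof -
    have "real j > 0"
      using that \<open>0 < i0\<close> by linarith
    have "?p j = (2 * real j - B) / (4 * real j)" "1 - ?p j = (2 * real j + B) / (4 * real j)"
      using that \<open>real j > 0\<close> by (simp_all add: perturbed_half_def field_simps)
    then show "?p j / (1 - ?p j) = (2 * real j - B) / (2 * real j + B)"
      "(1 - ?p j) / ?p j = (2 * real j + B) / (2 * real j - B)"
      using \<open>real j > 0\<close> by simp_all
    have "B < 2 * i0"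
      using assms(2,3) by (simp add: field_simps)
    with that show "B < 2 * real j" by linarith
  qed
  have p_half: "?p j = 1 / 2" if "\<not> real j > i0" for j
    using that by (simp add: perturbed_half_def)
  show ?thesis
  proof (intro conjI impI)
    assume "1 \<le> B"
    obtain n0 where "i0 \<le> real n0"
      using real_arch_simple by blast
    show "AE \<omega> in M. finite (regeneration_times Z \<omega>)"
    proof (rule AE_finite_regeneration_times[OF _ _ \<open>0 \<le> B\<close>])
      fix j assume "n0 < j"
      then have j: "real j > i0" "real j > 0"
        using \<open>i0 \<le> real n0\<close> by auto
      \<comment> \<open>After cross multiplication the claim reads
        \<open>2 * j \<le> 2 * B * j + B\<close>, which holds since \<open>B\<close> is at least
        1.\<close>
      have "real j * 2 \<le> B * (real j * 2)"
        using mult_right_mono[OF \<open>1 \<le> B\<close>, of "real j * 2"] by simp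
      then have "(2 * real j - B) * (real j + 1) \<le> real j * (2 * real j + B)"
        using \<open>1 \<le> B\<close> by (simp add: algebra_simps)
      then show "?p j / (1 - ?p j) \<le> real j / (real j + 1)"
        unfolding p_eq(1)[OF j(1)] using j(2) assms(1) by (simp add: divide_simps)
    next
      fix j :: nat assume "0 < j"
      show "1 - B / real j \<le> ?p j / (1 - ?p j)"
      proof (cases "real j > i0")
        case True
        \<comment> \<open>The two sides differ by exactly the square of \<open>B\<close>.\<close>
        have "(real j - B) * (2 * real j + B) \<le> (2 * real j - B) * real j"
          using assms(1) by (simp add: algebra_simps)
        then show ?thesis
          unfolding p_eq(1)[OF True] using \<open>0 < j\<close> assms(1) by (simp add: field_simps)
      qed (use assms(1) in \<open>simp add: p_half\<close>)
    qed
  next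
    assume "B < 1"
    \<comment> \<open>Cross multiplication will leave
      \<open>(1 + B) * B \<le> 2 * (1 - B) * j\<close>. The left side is at most 2, so
      \<open>j \<ge> 1 / (1 - B)\<close> suffices.\<close>
    obtain n0 where n0: "1 / (1 - B) \<le> real n0"
      using real_arch_simple by blast
    have "\<exists>c>0. \<forall>n. c / real (Suc n) \<le> odds_prod n / odds_sum 0 n"
    proof (rule odds_ratio_ge_inverse)
      \<comment> \<open>The midpoint of \<open>B\<close> and 1 leaves room for the second-order term
        of the inverse odds and is still below 1.\<close>
      show "(1 + B) / 2 < 1"
        using \<open>B < 1\<close> by simp
      fix j assume "n0 < j"
      show "(1 - ?p j) / ?p j \<le> 1 + (1 + B) / 2 / real j"
      proof (cases "real j > i0")
        case True
        have "1 / (1 - B) \<le> real j"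
          using n0 \<open>n0 < j\<close> by linarith
        then have "1 \<le> (1 - B) * real j"
          using \<open>B < 1\<close> by (simp add: field_simps)
        moreover have "(1 + B) * B \<le> 2 * 1"
          using \<open>B < 1\<close> assms(1) by (intro mult_mono) auto
        ultimately have "(1 + B) * B \<le> 2 * ((1 - B) * real j)" by linarith
        then have "(2 * real j + B) * (2 * real j) \<le> (2 * real j + (1 + B)) * (2 * real j - B)"
          by (simp add: algebra_simps)
        then show ?thesis
          unfolding p_eq(2)[OF True] using \<open>n0 < j\<close> p_eq(3)[OF True] by (simp add: field_simps)
      qed (use assms(1) in \<open>simp add: p_half\<close>)
    qed
    then show "AE \<omega> in M. infinite (regeneration_times Z \<omega>)"
      using AE_infinite_regeneration_times by blast
  qed
qed

end
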